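(* For every $X\subseteq\mathbb{N}$, the Boolean frame $\mathfrak{C}_X$ does not have the congruence extension property.
   Context: An algebra has the congruence extension property (CEP) if for every subalgebra $B$ and every congruence $\Theta$ of $B$ there is a congruence $\Psi$ of the algebra with $\Psi\cap(B\times B)=\Theta$. Let $E=\{2n:n\in\mathbb{N}\}$, $O=\{2n+1:n\in\mathbb{N}\}$, and let $E^*$ be the set of infinite $S\subseteq\mathbb{N}$ such that $S\cap O$ is finite and $E\setminus S$ is finite. For $n\in\mathbb{N}$ write $\overline{n}=\{n\}$ and $-\overline{n}=\mathbb{N}\setminus\{n\}$. For $X\subseteq\mathbb{N}$, $\mathfrak{C}_X=\langle\mathcal{P}(\mathbb{N}),g\rangle$ is the powerset Boolean algebra of $\mathbb{N}$ with $g$ defined for $S\subseteq\mathbb{N}$ by: $g(S)=\{0,\dots,n\}$ if $S=\{0,\dots,n-1\}$ for some $n\in\mathbb{N}$; $g(S)=S$ if $S\in E^*$; $g(S)=-\overline{n}$ if $S=-\overline{n}$ and $n\in X$; $g(S)=S\cup\{\max(S)+1\}$ if $S$ is finite and $S\neq\{0,\dots,n-1\}$ for all $n\in\mathbb{N}$; and $g(S)=\mathbb{N}$ otherwise. *)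

theory Defs
  imports Main
begin

text \<open>A Boolean frame is a Boolean algebra together with a unary operation. Its Boolean reduct is
  given here by the type (class \<^class>\<open>boolean_algebra\<close>), so a frame with universe \<^term>\<open>UNIV\<close> is
  determined by its unary operation \<^term>\<open>g\<close>.\<close>

definition bf_subalgebra :: "('a::boolean_algebra \<Rightarrow> 'a) \<Rightarrow> 'a set \<Rightarrow> bool" where
  "bf_subalgebra g B \<longleftrightarrow>
     bot \<in> B \<and> top \<in> B \<and>
     (\<forall>x\<in>B. \<forall>y\<in>B. inf x y \<in> B) \<and>
     (\<forall>x\<in>B. \<forall>y\<in>B. sup x y \<in> B) \<and>
     (\<forall>x\<in>B. - x \<in> B) \<and>
     (\<forall>x\<in>B. g x \<in> B)"

text \<open>\<^term>\<open>B\<close> is meant to be a subalgebra; the operations of that algebra are the restrictions of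
  the ambient ones.\<close>

definition bf_congruence ::
  "('a::boolean_algebra \<Rightarrow> 'a) \<Rightarrow> 'a set \<Rightarrow> ('a \<times> 'a) set \<Rightarrow> bool" where
  "bf_congruence g B \<Theta> \<longleftrightarrow>
     equiv B \<Theta> \<and>
     (\<forall>(x, x') \<in> \<Theta>. \<forall>(y, y') \<in> \<Theta>. (inf x y, inf x' y') \<in> \<Theta>) \<and>
     (\<forall>(x, x') \<in> \<Theta>. \<forall>(y, y') \<in> \<Theta>. (sup x y, sup x' y') \<in> \<Theta>) \<and>
     (\<forall>(x, x') \<in> \<Theta>. (- x, - x') \<in> \<Theta>) \<and>
     (\<forall>(x, x') \<in> \<Theta>. (g x, g x') \<in> \<Theta>)"

definition congruence_extension_property :: "('a::boolean_algebra \<Rightarrow> 'a) \<Rightarrow> bool" where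
  "congruence_extension_property g \<longleftrightarrow>
     (\<forall>B \<Theta>. bf_subalgebra g B \<and> bf_congruence g B \<Theta> \<longrightarrow>
       (\<exists>\<Psi>. bf_congruence g UNIV \<Psi> \<and> \<Psi> \<inter> (B \<times> B) = \<Theta>))"

definition Evens :: "nat set" where
  "Evens = {2 * n | n. True}"

definition Odds :: "nat set" where
  "Odds = {2 * n + 1 | n. True}"

definition Evens_star :: "nat set set" where
  "Evens_star = {S. infinite S \<and> finite (S \<inter> Odds) \<and> finite (Evens - S)}"

definition C_op :: "nat set \<Rightarrow> nat set \<Rightarrow> nat set" where
  "C_op X S =
     (if \<exists>n. S = {0..<n} then {0..(THE n. S = {0..<n})}
      else if S \<in> Evens_star then S
      else if \<exists>n\<in>X. S = - {n} then S
      else if finite S then S \<union> {Max S + 1}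
      else UNIV)"

lemma C_op_segment: "C_op X {0..<n} = {0..n}"
proof -
  have eq: "{0..<n} = {0..<m} \<longleftrightarrow> m = n" for m
    by (metis card_atLeastLessThan diff_zero)
  show ?thesis
    unfolding C_op_def eq by simp
qed

lemma C_op_Evens_star: "S \<in> Evens_star \<Longrightarrow> C_op X S = S"
  by (auto simp: C_op_def Evens_star_def)

lemma C_op_cosingleton: "n \<in> X \<Longrightarrow> C_op X (- {n}) = - {n}"
proof -
  assume "n \<in> X"
  moreover have "- {n} \<noteq> {0..<m}" for m
    by (metis finite_atLeastLessThan finite_compl finite.emptyI finite_insert infinite_UNIV_nat)
  ultimately show ?thesis
    by (auto simp: C_op_def)
qed

lemma C_op_finite:
  assumes "finite S" "\<And>n. S \<noteq> {0..<n}"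
  shows "C_op X S = S \<union> {Max S + 1}"
proof -
  have "S \<noteq> - {n}" for n
    using assms(1) by (metis finite_compl finite.emptyI finite_insert infinite_UNIV_nat)
  then show ?thesis
    using assms by (auto simp: C_op_def Evens_star_def)
qed

lemma C_op_otherwise:
  assumes "infinite S" "S \<notin> Evens_star" "\<And>n. n \<in> X \<Longrightarrow> S \<noteq> - {n}"
  shows "C_op X S = UNIV"
  using assms by (auto simp: C_op_def)

end

theory Submission
  imports Defs
begin

text \<open>The sets that are finite or cofinite on the evens and finite or cofinite on the odds form a
  subalgebra, and identifying two of them when both are finite on the odds, or both are not, is a
  congruence with two classes: within the subalgebra, an infinite set that is finite on the odds
  lies in \<^term>\<open>Evens_star\<close> and is fixed by the operation. In the full algebra an extension of this
  congruence identifies \<^term>\<open>{}\<close> with \<^term>\<open>Evens\<close>, hence with the multiples of 4, which the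
  operation sends to \<^term>\<open>UNIV\<close>; so it identifies \<^term>\<open>{0}\<close> with \<^term>\<open>UNIV\<close>, which lie in
  different classes.\<close>

definition almost_const_on :: "'a set \<Rightarrow> 'a set \<Rightarrow> bool" where
  "almost_const_on A S \<longleftrightarrow> finite (S \<inter> A) \<or> finite (A - S)"

lemma almost_const_on_finite: "finite S \<Longrightarrow> almost_const_on A S"
  by (simp add: almost_const_on_def)

lemma almost_const_on_UNIV: "almost_const_on A UNIV"
  by (simp add: almost_const_on_def)

lemma almost_const_on_Compl: "almost_const_on A (- S) \<longleftrightarrow> almost_const_on A S"
proof -
  have "- S \<inter> A = A - S" "A - - S = S \<inter> A" by auto
  then show ?thesis by (auto simp: almost_const_on_def)
qed

lemma almost_const_on_Int:
  assumes "almost_const_on A S" "almost_const_on A T"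
  shows "almost_const_on A (S \<inter> T)"
proof -
  have "A - S \<inter> T = (A - S) \<union> (A - T)" by auto
  moreover have "finite (S \<inter> T \<inter> A)" if "finite (S \<inter> A) \<or> finite (T \<inter> A)"
    using that by (auto intro: rev_finite_subset)
  ultimately show ?thesis using assms by (auto simp: almost_const_on_def)
qed

lemma almost_const_on_Un:
  assumes "almost_const_on A S" "almost_const_on A T"
  shows "almost_const_on A (S \<union> T)"
  using almost_const_on_Int[of A "- S" "- T"] assms almost_const_on_Compl[of A "S \<union> T"]
  by (simp add: almost_const_on_Compl)

lemma finite_Un_Int_iff: "finite ((S \<union> T) \<inter> A) \<longleftrightarrow> finite (S \<inter> A) \<and> finite (T \<inter> A)"
  by (simp add: Int_Un_distrib2)

text \<open>For infinite \<open>A\<close> the two alternatives in \<open>almost_const_on\<close>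
  exclude each other. With the rules for unions and intersections this makes
  \<open>S \<mapsto> infinite (S \<inter> A)\<close> a Boolean homomorphism from the sets almost
  constant on \<open>A\<close> to the truth values.\<close>

lemma finite_Compl_Int_iff:
  assumes "infinite A" "almost_const_on A S"
  shows "finite (- S \<inter> A) \<longleftrightarrow> infinite (S \<inter> A)"
proof -
  have "- S \<inter> A = A - S" "A = (S \<inter> A) \<union> (A - S)" by auto
  then show ?thesis using assms by (metis almost_const_on_def finite_Un)
qed

lemma finite_Int_Int_iff:
  assumes "infinite A" "almost_const_on A S" "almost_const_on A T"
  shows "finite (S \<inter> T \<inter> A) \<longleftrightarrow> finite (S \<inter> A) \<or> finite (T \<inter> A)"
proof -
  have "S \<inter> T = - (- S \<union> - T)" by auto
  then show ?thesis
    using assms finite_Compl_Int_iff[of A "- S \<union> - T"]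
    by (simp add: finite_Un_Int_iff finite_Compl_Int_iff almost_const_on_Un almost_const_on_Compl)
qed

lemma Evens_eq: "Evens = {n. even n}"
  by (auto simp: Evens_def)

lemma Odds_eq_Compl_Evens: "Odds = - Evens"
  by (auto simp: Odds_def Evens_eq elim: oddE)

lemma infinite_Odds: "infinite Odds"
proof -
  have "Odds = range (\<lambda>n. 2 * n + 1)" by (auto simp: Odds_def)
  moreover have "inj (\<lambda>n::nat. 2 * n + 1)" by (simp add: inj_def)
  ultimately show ?thesis using finite_imageD infinite_UNIV_nat by metis
qed

lemma finite_C_op: "finite S \<Longrightarrow> finite (C_op X S)"
  by (cases "\<exists>n. S = {0..<n}") (auto simp: C_op_segment C_op_finite)

text \<open>Removes \<open>X\<close> from the argument: it only decides whether a set
  \<open>- {n}\<close> is fixed or sent to \<open>UNIV\<close>, and both outcomes are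
  covered.\<close>

lemma C_op_infinite_cases: "infinite S \<Longrightarrow> C_op X S = S \<or> S \<notin> Evens_star \<and> C_op X S = UNIV"
  using C_op_Evens_star C_op_cosingleton C_op_otherwise by metis

definition parity_algebra :: "nat set set" where
  "parity_algebra = {S. almost_const_on Evens S \<and> almost_const_on Odds S}"

definition odd_part_congruence :: "(nat set \<times> nat set) set" where
  "odd_part_congruence =
     {(S, T). S \<in> parity_algebra \<and> T \<in> parity_algebra \<and>
        (finite (S \<inter> Odds) \<longleftrightarrow> finite (T \<inter> Odds))}"

lemma C_op_in_parity_algebra:
  assumes "S \<in> parity_algebra"
  shows "C_op X S \<in> parity_algebra"
proof (cases "finite S")
  case True
  then show ?thesis by (simp add: parity_algebra_def almost_const_on_finite finite_C_op)
next
  case False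
  then show ?thesis using C_op_infinite_cases[OF False, of X] assms
    by (auto simp: parity_algebra_def almost_const_on_UNIV)
qed

text \<open>The operation keeps every member of \<open>parity_algebra\<close> in its class, so it
  acts as the identity on the two-element quotient.\<close>

lemma finite_C_op_Int_Odds:
  assumes "S \<in> parity_algebra"
  shows "finite (C_op X S \<inter> Odds) \<longleftrightarrow> finite (S \<inter> Odds)"
proof (cases "finite S")
  case True
  then show ?thesis by (simp add: finite_C_op)
next
  case False
  \<comment> \<open>Being infinite, such a set has infinitely many evens, and almost constancy on
    \<open>Evens\<close> then leaves only finitely many evens outside it.\<close>
  have "S \<in> Evens_star" if "finite (S \<inter> Odds)"
  proof -
    have "S = (S \<inter> Evens) \<union> (S \<inter> Odds)" by (auto simp: Odds_eq_Compl_Evens)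
    then have "infinite (S \<inter> Evens)" using False that by (metis finite_Un)
    then show ?thesis using assms False that
      by (auto simp: parity_algebra_def almost_const_on_def Evens_star_def)
  qed
  then show ?thesis using C_op_infinite_cases[OF False, of X] infinite_Odds by auto
qed

lemma bf_subalgebra_parity_algebra: "bf_subalgebra (C_op X) parity_algebra"
  unfolding bf_subalgebra_def
  by (auto simp: C_op_in_parity_algebra)
    (auto simp: parity_algebra_def almost_const_on_finite almost_const_on_UNIV
      almost_const_on_Int almost_const_on_Un almost_const_on_Compl)

lemma bf_congruence_odd_part_congruence:
  "bf_congruence (C_op X) parity_algebra odd_part_congruence"
proof -
  have "equiv parity_algebra odd_part_congruence"
    by (rule equivI) (auto simp: odd_part_congruence_def refl_on_def sym_def trans_def)
  moreover have "(S \<inter> T, S' \<inter> T') \<in> odd_part_congruence"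
    and "(S \<union> T, S' \<union> T') \<in> odd_part_congruence"
    if "(S, S') \<in> odd_part_congruence" "(T, T') \<in> odd_part_congruence" for S S' T T'
    using that
    by (simp_all add: odd_part_congruence_def parity_algebra_def infinite_Odds
        almost_const_on_Int almost_const_on_Un finite_Un_Int_iff finite_Int_Int_iff)
  moreover have "(- S, - S') \<in> odd_part_congruence"
    and "(C_op X S, C_op X S') \<in> odd_part_congruence"
    if "(S, S') \<in> odd_part_congruence" for S S'
    using that C_op_in_parity_algebra finite_C_op_Int_Odds
    by (simp_all add: odd_part_congruence_def parity_algebra_def infinite_Odds
        almost_const_on_Compl finite_Compl_Int_iff)
  ultimately show ?thesis
    unfolding bf_congruence_def by blast
qed

lemma C_op_multiples_of_4: "C_op X (range (\<lambda>n. 4 * n)) = UNIV"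
proof (rule C_op_otherwise)
  show "infinite (range (\<lambda>n::nat. 4 * n))"
    by (simp add: finite_image_iff inj_on_def)
  \<comment> \<open>The evens not divisible by 4 form an infinite set of missing evens.\<close>
  have "range (\<lambda>n. 4 * n + 2) \<subseteq> Evens - range (\<lambda>n. 4 * n)"
    unfolding Evens_eq by (auto, presburger)
  moreover have "infinite (range (\<lambda>n::nat. 4 * n + 2))"
    by (simp add: finite_image_iff inj_on_def)
  ultimately show "range (\<lambda>n. 4 * n) \<notin> Evens_star"
    using finite_subset by (auto simp: Evens_star_def)
  show "range (\<lambda>n. 4 * n) \<noteq> - {n}" for n :: nat
  proof -
    \<comment> \<open>Two missing numbers rule out every complement of a singleton, whatever
      \<open>X\<close> is.\<close>
    have "1 \<notin> range (\<lambda>n::nat. 4 * n)" "3 \<notin> range (\<lambda>n::nat. 4 * n)"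
      by (auto, presburger+)
    moreover have "1 \<in> - {n} \<or> 3 \<in> - {n}" by auto
    ultimately show ?thesis by metis
  qed
qed

theorem theorem2p8:
  fixes X :: "nat set"
  shows "\<not> congruence_extension_property (C_op X)"
proof
  let ?D = "range (\<lambda>n::nat. 4 * n)"
  assume "congruence_extension_property (C_op X)"
  then obtain \<Psi> where cong: "bf_congruence (C_op X) UNIV \<Psi>"
    and ext: "\<Psi> \<inter> (parity_algebra \<times> parity_algebra) = odd_part_congruence"
    unfolding congruence_extension_property_def
    using bf_subalgebra_parity_algebra bf_congruence_odd_part_congruence by blast
  have "({}, Evens) \<in> odd_part_congruence"
    by (simp add: odd_part_congruence_def parity_algebra_def almost_const_on_def Odds_eq_Compl_Evens)
  then have "({}, Evens) \<in> \<Psi>" using ext by blast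
  \<comment> \<open>\<open>?D\<close> lies outside \<open>parity_algebra\<close>, since it contains
    infinitely many evens and misses infinitely many. So this is where the full algebra
    enters.\<close>
  moreover have "(?D, ?D) \<in> \<Psi>"
    using cong by (auto simp: bf_congruence_def equiv_def refl_on_def)
  ultimately have "(?D \<inter> {}, ?D \<inter> Evens) \<in> \<Psi>"
    using cong unfolding bf_congruence_def by blast
  moreover have "?D \<inter> Evens = ?D"
    by (auto simp: Evens_eq)
  ultimately have "({}, ?D) \<in> \<Psi>" by simp
  then have "(C_op X {}, C_op X ?D) \<in> \<Psi>"
    using cong unfolding bf_congruence_def by blast
  \<comment> \<open>\<open>{}\<close> is the initial segment \<open>{0..<0}\<close>, so its image is
    \<open>{0}\<close>.\<close>
  then have "({0}, UNIV) \<in> \<Psi>"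
    using C_op_segment[of X 0] by (simp add: C_op_multiples_of_4)
  then have "({0}, UNIV) \<in> odd_part_congruence"
    unfolding ext[symmetric]
    by (simp add: parity_algebra_def almost_const_on_finite almost_const_on_UNIV)
  then show False
    by (simp add: odd_part_congruence_def infinite_Odds)
qed

end
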